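(* Let $\alpha\in(0,1)$. (i) Suppose $R^{ES_\alpha}(Y)\in\widehat{\mathcal P}(\mathbb R^d;\mathbb R^d_+)$ for all $Y\in\mathcal Y^d$. Then for every $k\in\mathbb R^d$ the function $S_k\colon\mathbb R^{\mathbb R^d}\times\widehat{\mathcal P}(\mathbb R^d;\mathbb R^d_+)\times\mathbb R^d\to[0,\infty)$, $$S_k(v,A,y)=-\mathbf 1_A(k)U_2(v,k,y)+\mathbf 1_{R^{ES_\alpha}(y)}(k)\Lambda(y+k),$$ is a non-negative $\mathcal M^d$-consistent exhaustive scoring function for $(T^{\mathrm{VaR}_\alpha},R^{ES_\alpha})\colon\mathcal M^d\to\mathbb R^{\mathbb R^d}\times\widehat{\mathcal P}(\mathbb R^d;\mathbb R^d_+)$. (ii) Suppose $R^{ES_\alpha}(Y)\in\widehat{\mathcal P}(\mathbb R^d;\mathbb R^d_+)$ for all $Y\in\mathcal Y^d$, let $\pi_1,\pi_2$ be $\sigma$-finite non-negative measures on $\mathcal B(\mathbb R^d)$, and for each $k\in\mathbb R^d$ let $g_k\colon\mathbb R\to\mathbb R$ be non-decreasing. Then the map $S_{\pi_1,\pi_2}\colon\mathbb R^{\mathbb R^d}\times\widehat{\mathcal P}(\mathbb R^d;\mathbb R^d_+)\times\mathbb R^d\to[0,\infty]$, $$S_{\pi_1,\pi_2}(v,A,y)=\int_{\mathbb R^d}S_{\alpha,g_k}(-v(k),\Lambda(y+k))\,\pi_1(dk)+\int_{\mathbb R^d}S_k(v,A,y)\,\pi_2(dk),$$ is a non-negative $\mathcal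 M^d$-consistent exhaustive scoring function for $(T^{\mathrm{VaR}_\alpha},R^{ES_\alpha})\colon\mathcal M^d\to\mathbb R^{\mathbb R^d}\times\widehat{\mathcal P}(\mathbb R^d;\mathbb R^d_+)$. (iii) Suppose that for all $Y\in\mathcal Y^d$, $R^{ES_\alpha}(Y)\in\mathcal F(\mathbb R^d;\mathbb R^d_+)$ and $\{k: ES_\alpha(\Lambda(Y+k))=0\}$ equals the topological boundary $\partial R^{ES_\alpha}(Y)$; that all distribution functions in $\mathcal M$ are continuous and strictly increasing; that $T^{\mathrm{VaR}_\alpha}$ takes only values in $\mathcal C(\mathbb R^d;\mathbb R)$; that $g_k$ is strictly increasing for all $k\in\mathbb R^d$; and that $\pi_1,\pi_2$ (as in (ii)) are strictly positive. Then the restriction of $S_{\pi_1,\pi_2}$ to $\mathcal C(\mathbb R^d;\mathbb R)\times\mathcal F(\mathbb R^d;\mathbb R^d_+)\times\mathbb R^d$ is a non-negative strictly $\mathcal M^d_0$-consistent exhaustive scoring function for $(T^{\mathrm{VaR}_\alpha},R^{ES_\alpha})\colon\mathcal M_0^d\to\mathcal C(\mathbb R^d;\mathbb R)\times\mathcal F(\mathbb R^d;\mathbb R^d_+)$, where $\mathcal M^d_0\subseteq\mathcal M^d$ is such that $\bar S_{\pi_1,\pi_2}(T^{\mathrm{VaR}_\alpha}(F),R^{ES_\alpha}(F),F)<\infty$ for all $F\in\mathcal M_0^d$.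
   Context: Setting: $(\Omega,\mathfrak F,\mathbb P)$ is an atomless probability space, $d\ge1$, $\mathcal Y^d\subseteq L^0(\Omega;\mathbb R^d)$ is a class of random vectors closed under translation by constants. $\Lambda\colon\mathbb R^d\to\mathbb R$ is non-decreasing for the componentwise order (an aggregation function). $\mathcal Y\subseteq L^0(\Omega;\mathbb R)$ contains $\Lambda(Y)$ for all $Y\in\mathcal Y^d$ (hence $\Lambda(Y+k)\in\mathcal Y$ for all $k\in\mathbb R^d$). $\mathcal M^d$ and $\mathcal M$ are the classes of distributions of elements of $\mathcal Y^d$ and $\mathcal Y$. For a distribution function $F$ on $\mathbb R$: $\mathrm{VaR}_\alpha(F)=-\inf\{x\in\mathbb R:\alpha\le F(x)\}$ and $ES_\alpha(F)=\frac1\alpha\int_0^\alpha\mathrm{VaR}_\beta(F)\,d\beta$; for a random variable $X$ with distribution $F$, $\mathrm{VaR}_\alpha(X)=\mathrm{VaR}_\alpha(F)$, $ES_\alpha(X)=ES_\alpha(F)$. $ES_\alpha$ is assumed real-valued on $\mathcal M$. For $Y\in\mathcal Y^d$ with distribution $F$: $R^{ES_\alpha}(F)=R^{ES_\alpha}(Y)=\{k\in\mathbb R^d: ES_\alpha(\Lambda(Y+k))\le0\}$ and $T^{\mathrm{VaR}_\alpha}(F)=T^{\mathrm{VaR}_\alpha}(Y)\colon\mathbb R^d\to\mathbb R$, $k\mapsto\mathrm{VaR}_\alpha(\Lambda(Y+k))$. For $y\in\mathbb R^d$, $R^{ES_\alpha}(y)=R^{ES_\alpha}(\delta_y)=\{k:\Lambda(y+k)\ge0\}$.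 $\mathbb R^{\mathbb R^d}$ is the set of functions $\mathbb R^d\to\mathbb R$ and $\mathcal C(\mathbb R^d;\mathbb R)$ the subset of continuous ones. For $v\in\mathbb R^{\mathbb R^d}$, $k,y\in\mathbb R^d$: $$U_2(v,k,y)=\tfrac1\alpha\mathbf 1\{\Lambda(y+k)\le-v(k)\}\Lambda(y+k)+\tfrac1\alpha\big(\mathbf 1\{\Lambda(y+k)\le-v(k)\}-\alpha\big)v(k).$$ For non-decreasing $g\colon\mathbb R\to\mathbb R$ and $x,z\in\mathbb R$: $S_{\alpha,g}(x,z)=(\mathbf 1\{z\le x\}-\alpha)(g(x)-g(z))$. $\widehat{\mathcal P}(\mathbb R^d;\mathbb R^d_+)$ is the class of Borel sets $B\subseteq\mathbb R^d$ with $B=B+\mathbb R^d_+$ (upper sets; $\emptyset$ is allowed) and $B\ne\mathbb R^d$; $\mathcal F(\mathbb R^d;\mathbb R^d_+)\subset\widehat{\mathcal P}(\mathbb R^d;\mathbb R^d_+)$ is the subclass of closed upper sets. A measure on $\mathcal B(\mathbb R^d)$ is strictly positive if it gives positive mass to every non-empty open set. $\bar S(v,A,F)=\int S(v,A,y)\,dF(y)$; all integrals (over $y$ and over $k$) are tacitly assumed well defined, i.e. the integrands (including $(k,x)\mapsto g_k(x)$ and the functions $v$ considered) are suitably measurable. For classes $\mathcal C'\subseteq\mathbb R^{\mathbb R^d}$, $\mathcal A$ of sets and $\mathcal N$ of distributions, a score $S\colon\mathcal C'\times\mathcal A\times\mathbb R^d\to(-\infty,\infty]$ is an $\mathcal N$-consistent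 exhaustive scoring function for $(T,R)\colon\mathcal N\to\mathcal C'\times\mathcal A$ if $\bar S(T(F),R(F),F)\le\bar S(v,A,F)$ for all $(v,A)\in\mathcal C'\times\mathcal A$, $F\in\mathcal N$; it is strictly $\mathcal N$-consistent if in addition equality implies $(v,A)=(T(F),R(F))$. *)

theory Defs
  imports "HOL-Probability.Probability"
begin

definition atomless :: "'w measure \<Rightarrow> bool" where
  "atomless M \<longleftrightarrow> (\<forall>A\<in>sets M. emeasure M A > 0 \<longrightarrow>
     (\<exists>B\<in>sets M. B \<subseteq> A \<and> 0 < emeasure M B \<and> emeasure M B < emeasure M A))"

definition laws :: "'w measure \<Rightarrow> ('w \<Rightarrow> 'e::topological_space) set \<Rightarrow> 'e measure set" where
  "laws M X = (\<lambda>Y. distr M borel Y) ` X"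

text \<open>The second argument of the next two functions is a distribution function.  The integral
  over \<open>(0, \<alpha>)\<close> is real exactly if \<open>\<beta> \<mapsto> VaR \<beta> F\<close> is integrable there;
  \<open>ES_real\<close> expresses this.\<close>

definition VaR :: "real \<Rightarrow> (real \<Rightarrow> real) \<Rightarrow> real" where
  "VaR \<alpha> F = - Inf {x. \<alpha> \<le> F x}"

definition ES :: "real \<Rightarrow> (real \<Rightarrow> real) \<Rightarrow> real" where
  "ES \<alpha> F = 1 / \<alpha> * (LINT \<beta>:{0<..<\<alpha>}|lborel. VaR \<beta> F)"

definition ES_real :: "real \<Rightarrow> (real \<Rightarrow> real) \<Rightarrow> bool" where
  "ES_real \<alpha> F \<longleftrightarrow> set_integrable lborel {0<..<\<alpha>} (\<lambda>\<beta>. VaR \<beta> F)"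

text \<open>The distribution function of \<open>\<Lambda> (Y + k)\<close>, as a function of the law \<open>F\<close> of \<open>Y\<close>
  (see \<open>agg_df_distr\<close>).\<close>

definition agg_df :: "(real^'d \<Rightarrow> real) \<Rightarrow> (real^'d) measure \<Rightarrow> real^'d \<Rightarrow> real \<Rightarrow> real" where
  "agg_df \<Lambda> F k = cdf (distr F borel (\<lambda>y. \<Lambda> (y + k)))"

definition T_VaR :: "real \<Rightarrow> (real^'d \<Rightarrow> real) \<Rightarrow> (real^'d) measure \<Rightarrow> real^'d \<Rightarrow> real" where
  "T_VaR \<alpha> \<Lambda> F = (\<lambda>k. VaR \<alpha> (agg_df \<Lambda> F k))"

definition R_ES :: "real \<Rightarrow> (real^'d \<Rightarrow> real) \<Rightarrow> (real^'d) measure \<Rightarrow> (real^'d) set" where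
  "R_ES \<alpha> \<Lambda> F = {k. ES \<alpha> (agg_df \<Lambda> F k) \<le> 0}"

text \<open>Proper Borel upper sets, and the closed ones among them.  On \<open>real^'d\<close>, \<open>\<le>\<close> is the
  componentwise order.\<close>

definition upper_sets :: "(real^'d) set set" where
  "upper_sets = {B. B \<in> sets borel \<and> B = {b + x |b x. b \<in> B \<and> 0 \<le> x} \<and> B \<noteq> UNIV}"

definition closed_upper_sets :: "(real^'d) set set" where
  "closed_upper_sets = {B \<in> upper_sets. closed B}"

definition strictly_positive :: "'e::topological_space measure \<Rightarrow> bool" where
  "strictly_positive \<pi> \<longleftrightarrow> (\<forall>U. open U \<and> U \<noteq> {} \<longrightarrow> emeasure \<pi> U > 0)"

definition U2 :: "real \<Rightarrow> (real^'d \<Rightarrow> real) \<Rightarrow> (real^'d \<Rightarrow> real) \<Rightarrow> real^'d \<Rightarrow> real^'d \<Rightarrow> real" where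
  "U2 \<alpha> \<Lambda> v k y =
     1 / \<alpha> * of_bool (\<Lambda> (y + k) \<le> - v k) * \<Lambda> (y + k)
     + 1 / \<alpha> * (of_bool (\<Lambda> (y + k) \<le> - v k) - \<alpha>) * v k"

definition S_quantile :: "real \<Rightarrow> (real \<Rightarrow> real) \<Rightarrow> real \<Rightarrow> real \<Rightarrow> real" where
  "S_quantile \<alpha> g x z = (of_bool (z \<le> x) - \<alpha>) * (g x - g z)"

text \<open>The set \<open>R_ES \<alpha> \<Lambda> (return borel y)\<close> (Dirac measure at \<open>y\<close>) is \<open>{k. 0 \<le> \<Lambda> (y + k)}\<close>
  (see \<open>R_ES_return\<close>).\<close>

definition S_elem :: "real \<Rightarrow> (real^'d \<Rightarrow> real) \<Rightarrow> real^'d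
    \<Rightarrow> (real^'d \<Rightarrow> real) \<Rightarrow> (real^'d) set \<Rightarrow> real^'d \<Rightarrow> real" where
  "S_elem \<alpha> \<Lambda> k v A y =
     - (indicator A k * U2 \<alpha> \<Lambda> v k y) + indicator (R_ES \<alpha> \<Lambda> (return borel y)) k * \<Lambda> (y + k)"

text \<open>Integral of an extended real function: positive part minus negative part
  (\<open>e2ennreal\<close> sends negative numbers to 0).\<close>

definition ereal_integral :: "'e measure \<Rightarrow> ('e \<Rightarrow> ereal) \<Rightarrow> ereal" where
  "ereal_integral M f =
     enn2ereal (\<integral>\<^sup>+ x. e2ennreal (f x) \<partial>M) - enn2ereal (\<integral>\<^sup>+ x. e2ennreal (- f x) \<partial>M)"

definition S_mix :: "real \<Rightarrow> (real^'d \<Rightarrow> real) \<Rightarrow> (real^'d \<Rightarrow> real \<Rightarrow> real)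
    \<Rightarrow> (real^'d) measure \<Rightarrow> (real^'d) measure
    \<Rightarrow> (real^'d \<Rightarrow> real) \<Rightarrow> (real^'d) set \<Rightarrow> real^'d \<Rightarrow> ereal" where
  "S_mix \<alpha> \<Lambda> g \<pi>1 \<pi>2 v A y =
     ereal_integral \<pi>1 (\<lambda>k. ereal (S_quantile \<alpha> (g k) (- v k) (\<Lambda> (y + k))))
     + ereal_integral \<pi>2 (\<lambda>k. ereal (S_elem \<alpha> \<Lambda> k v A y))"

definition mean_score :: "('v \<Rightarrow> 'a \<Rightarrow> 'e \<Rightarrow> ereal) \<Rightarrow> 'v \<Rightarrow> 'a \<Rightarrow> 'e measure \<Rightarrow> ereal" where
  "mean_score S v A F = ereal_integral F (\<lambda>y. S v A y)"

definition consistent_score :: "('v \<Rightarrow> 'a \<Rightarrow> 'e \<Rightarrow> ereal) \<Rightarrow> 'e measure set \<Rightarrow> 'v set \<Rightarrow> 'a set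
    \<Rightarrow> ('e measure \<Rightarrow> 'v) \<Rightarrow> ('e measure \<Rightarrow> 'a) \<Rightarrow> bool" where
  "consistent_score S N C \<A> T R \<longleftrightarrow>
     (\<forall>F\<in>N. T F \<in> C \<and> R F \<in> \<A>) \<and>
     (\<forall>v\<in>C. \<forall>A\<in>\<A>. \<forall>y. S v A y \<noteq> - \<infinity>) \<and>
     (\<forall>F\<in>N. \<forall>v\<in>C. \<forall>A\<in>\<A>. mean_score S (T F) (R F) F \<le> mean_score S v A F)"

definition strictly_consistent_score :: "('v \<Rightarrow> 'a \<Rightarrow> 'e \<Rightarrow> ereal) \<Rightarrow> 'e measure set \<Rightarrow> 'v set
    \<Rightarrow> 'a set \<Rightarrow> ('e measure \<Rightarrow> 'v) \<Rightarrow> ('e measure \<Rightarrow> 'a) \<Rightarrow> bool" where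
  "strictly_consistent_score S N C \<A> T R \<longleftrightarrow>
     consistent_score S N C \<A> T R \<and>
     (\<forall>F\<in>N. \<forall>v\<in>C. \<forall>A\<in>\<A>. mean_score S (T F) (R F) F = mean_score S v A F
        \<longrightarrow> v = T F \<and> A = R F)"

definition nonneg_score :: "('v \<Rightarrow> 'a \<Rightarrow> 'e \<Rightarrow> ereal) \<Rightarrow> 'v set \<Rightarrow> 'a set \<Rightarrow> bool" where
  "nonneg_score S C \<A> \<longleftrightarrow> (\<forall>v\<in>C. \<forall>A\<in>\<A>. \<forall>y. 0 \<le> S v A y)"

lemma agg_df_distr:
  fixes \<Lambda> :: "real^'d \<Rightarrow> real"
  assumes [measurable]: "\<Lambda> \<in> borel_measurable borel" "Y \<in> borel_measurable M"
  shows "agg_df \<Lambda> (distr M borel Y) k = cdf (distr M borel (\<lambda>\<omega>. \<Lambda> (Y \<omega> + k)))"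
  unfolding agg_df_def by (subst distr_distr) (simp_all add: comp_def)

lemma R_ES_return:
  fixes \<Lambda> :: "real^'d \<Rightarrow> real"
  assumes [measurable]: "\<Lambda> \<in> borel_measurable borel" and \<alpha>: "0 < \<alpha>" "\<alpha> < 1"
  shows "R_ES \<alpha> \<Lambda> (return borel y) = {k. 0 \<le> \<Lambda> (y + k)}"
proof -
  have "ES \<alpha> (agg_df \<Lambda> (return borel y) k) = - \<Lambda> (y + k)" for k
  proof -
    define c where "c = \<Lambda> (y + k)"
    have df: "agg_df \<Lambda> (return borel y) k x = of_bool (c \<le> x)" for x
      unfolding agg_df_def by (subst distr_return)
        (auto simp: cdf_def measure_return c_def indicator_def)
    have "VaR \<beta> (agg_df \<Lambda> (return borel y) k) = - c" if "\<beta> \<in> {0<..<\<alpha>}" for \<beta>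
    proof -
      have "{x. \<beta> \<le> agg_df \<Lambda> (return borel y) k x} = {c..}"
        using that \<alpha> by (auto simp: df split: if_splits)
      then show ?thesis by (simp add: VaR_def)
    qed
    then have "(LINT \<beta>:{0<..<\<alpha>}|lborel. VaR \<beta> (agg_df \<Lambda> (return borel y) k))
        = (LINT \<beta>:{0<..<\<alpha>}|lborel. - c)"
      by (intro set_lebesgue_integral_cong) auto
    also have "\<dots> = - c * \<alpha>"
      using \<alpha> by (simp add: set_lebesgue_integral_def)
    finally show ?thesis using \<alpha> by (simp add: ES_def c_def)
  qed
  then show ?thesis by (simp add: R_ES_def)
qed

end

theory Submission
  imports Defs
begin

text \<open>For fixed \<open>k\<close> everything depends on \<open>y\<close> only through \<open>z = \<Lambda> (y + k)\<close>.  With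
  \<open>x = - v k\<close>, the score \<open>S\<^sub>k\<close> becomes \<open>max 0 z\<close> minus, if \<open>k \<in> A\<close>, the gain
  \<open>x - max 0 (x - z) / \<alpha>\<close> (\<open>U\<^sub>2\<close> in the paper), whose mean is maximal at the \<open>\<alpha>\<close>-quantile, with
  maximum \<open>- ES \<alpha>\<close>; hence it is optimal to collect it exactly when \<open>ES \<alpha> \<le> 0\<close>.  The means of
  the scores may be infinite, but differences of two scores are integrable, so only these are
  compared.  Tonelli's theorem transfers the comparison to the mixtures.  If the finite minimum is
  attained, \<open>v\<close> is optimal \<open>\<pi>1\<close>-almost everywhere, hence everywhere by continuity, and \<open>A\<close> agrees
  with \<open>R\<close> off the boundary of \<open>R\<close> \<open>\<pi>2\<close>-almost everywhere.  This forces \<open>A = R\<close>, since the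
  difference of a closed upper set and a closed set contains a non-empty open set unless it is
  empty.\<close>

section \<open>Comparing integrals of non-negative functions\<close>

text \<open>Either integral may be infinite, so only the difference is assumed integrable. If
  \<open>h\<close> has a finite integral, then \<open>f = h - (h - f)\<close> is integrable too, and
  the real integrals can be compared.\<close>

lemma nn_integral_le_of_integral_diff_nonneg:
  fixes f h :: "'a \<Rightarrow> real"
  assumes [measurable]: "f \<in> borel_measurable M" "h \<in> borel_measurable M"
    and nn: "\<And>x. 0 \<le> f x" "\<And>x. 0 \<le> h x"
    and int: "integrable M (\<lambda>x. h x - f x)" and ge: "0 \<le> (\<integral>x. h x - f x \<partial>M)"
  shows "(\<integral>\<^sup>+x. ennreal (f x) \<partial>M) \<le> (\<integral>\<^sup>+x. ennreal (h x) \<partial>M)"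
proof (cases "(\<integral>\<^sup>+x. ennreal (h x) \<partial>M) = \<infinity>")
  case False
  then have h: "integrable M h"
    using nn by (intro integrableI_bounded) (auto simp: top.not_eq_extremum)
  have f: "integrable M f"
    using Bochner_Integration.integrable_diff[OF h int] by simp
  have "integral\<^sup>L M f \<le> integral\<^sup>L M h"
    using ge h f by simp
  then show ?thesis
    using h f nn by (simp add: nn_integral_eq_integral)
qed auto

text \<open>A strict inequality would be lost at infinity. Finiteness of the smaller integral makes
  \<open>f\<close>, and hence \<open>h = f + (h - f)\<close>, integrable.\<close>

lemma nn_integral_less_of_integral_diff_pos:
  fixes f h :: "'a \<Rightarrow> real"
  assumes [measurable]: "f \<in> borel_measurable M" "h \<in> borel_measurable M"
    and nn: "\<And>x. 0 \<le> f x" "\<And>x. 0 \<le> h x"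
    and int: "integrable M (\<lambda>x. h x - f x)" and gt: "0 < (\<integral>x. h x - f x \<partial>M)"
    and fin: "(\<integral>\<^sup>+x. ennreal (f x) \<partial>M) < \<infinity>"
  shows "(\<integral>\<^sup>+x. ennreal (f x) \<partial>M) < (\<integral>\<^sup>+x. ennreal (h x) \<partial>M)"
proof -
  have f: "integrable M f"
    using nn fin by (intro integrableI_bounded) auto
  have h: "integrable M h"
    using Bochner_Integration.integrable_add[OF f int] by simp
  have "integral\<^sup>L M f < integral\<^sup>L M h"
    using gt h f by simp
  then show ?thesis
    using h f nn by (simp add: nn_integral_eq_integral ennreal_less_iff)
qed

text \<open>Finiteness allows subtraction, after which the non-negative function
  \<open>h - f\<close> has integral zero.\<close>

lemma AE_eq_of_nn_integral_eq:
  fixes f h :: "'a \<Rightarrow> ennreal"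
  assumes [measurable]: "f \<in> borel_measurable M" "h \<in> borel_measurable M"
    and le: "\<And>x. f x \<le> h x"
    and eq: "integral\<^sup>N M f = integral\<^sup>N M h" and fin: "integral\<^sup>N M f < \<infinity>"
  shows "AE x in M. f x = h x"
proof -
  have "(\<integral>\<^sup>+x. h x - f x \<partial>M) = integral\<^sup>N M h - integral\<^sup>N M f"
    using fin le by (intro nn_integral_diff) auto
  also have "\<dots> = 0"
    using eq fin by simp
  finally have "AE x in M. h x - f x = 0"
    by (simp add: nn_integral_0_iff_AE)
  moreover have "AE x in M. f x \<noteq> \<infinity>"
    using fin by (intro nn_integral_PInf_AE) auto
  ultimately show ?thesis
  proof eventually_elim
    case (elim x)
    then have "h x \<le> f x" by (simp add: diff_eq_0_iff_ennreal)
    with le show ?case by (rule antisym)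
  qed
qed

section \<open>Scores of a real distribution\<close>

text \<open>This is the integrand of the Rockafellar-Uryasev representation of expected
  shortfall.\<close>

definition es_gain :: "real \<Rightarrow> real \<Rightarrow> real \<Rightarrow> real" where
  "es_gain \<alpha> x z = x - max 0 (x - z) / \<alpha>"

text \<open>The Boolean stands for \<open>k \<in> A\<close>. The term \<open>max 0 z\<close> depends
  on neither \<open>a\<close> nor \<open>x\<close>: it cancels in differences and keeps the score
  non-negative.\<close>

definition es_score :: "real \<Rightarrow> bool \<Rightarrow> real \<Rightarrow> real \<Rightarrow> real" where
  "es_score \<alpha> a x z = max 0 z - of_bool a * es_gain \<alpha> x z"

lemma es_gain_measurable [measurable]: "es_gain \<alpha> x \<in> borel_measurable borel"
  unfolding es_gain_def by measurable

lemma es_score_measurable [measurable]: "es_score \<alpha> a x \<in> borel_measurable borel"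
  unfolding es_score_def by measurable

lemma S_quantile_measurable [measurable]:
  assumes "mono g" shows "S_quantile \<alpha> g x \<in> borel_measurable borel"
proof -
  have [measurable]: "g \<in> borel_measurable borel"
    using assms by (rule borel_measurable_mono)
  show ?thesis unfolding S_quantile_def by measurable
qed

text \<open>The two factors never have opposite signs: both are non-negative for
  \<open>z \<le> x\<close> and non-positive otherwise.\<close>

lemma S_quantile_nonneg:
  assumes "mono g" "0 < \<alpha>" "\<alpha> < 1" shows "0 \<le> S_quantile \<alpha> g x z"
  using assms monoD[OF assms(1), of x z] monoD[OF assms(1), of z x]
  by (auto simp: S_quantile_def mult_le_0_iff split: split_of_bool)

lemma es_gain_le:
  assumes "0 < \<alpha>" "\<alpha> < 1" shows "es_gain \<alpha> x z \<le> z"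
proof (cases "z \<le> x")
  case True
  then have "(x - z) * \<alpha> \<le> x - z"
    using assms by (intro mult_left_le) auto
  then show ?thesis using True assms by (simp add: es_gain_def field_simps)
qed (simp add: es_gain_def)

lemma es_score_nonneg:
  assumes "0 < \<alpha>" "\<alpha> < 1" shows "0 \<le> es_score \<alpha> a x z"
  using es_gain_le[OF assms, of x z] by (auto simp: es_score_def)

text \<open>The quantile score with \<open>g = id\<close> equals
  \<open>\<alpha> * z - \<alpha> * es_gain \<alpha> x z\<close>. Thus minimising one means
  maximising the other, and optimality of the quantile carries over to the gain.\<close>

lemma S_quantile_id_diff:
  assumes "\<alpha> \<noteq> 0"
  shows "S_quantile \<alpha> id x z - S_quantile \<alpha> id q z = \<alpha> * (es_gain \<alpha> q z - es_gain \<alpha> x z)"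
  using assms by (auto simp: S_quantile_def es_gain_def algebra_simps)

section \<open>Optimality of the quantile and of expected shortfall for one real
  distribution\<close>

context cdf_distribution
begin

lemma measure_greaterThanAtMost: "x \<le> y \<Longrightarrow> measure M {x<..y} = C y - C x"
  using cdf_diff_eq[of x y] by (cases "x = y") auto

context
  fixes \<alpha> q :: real
  assumes \<alpha>: "0 < \<alpha>" "\<alpha> < 1" and q_def: "q = I \<alpha>"
begin

lemma cdf_quantile_ge: "\<alpha> \<le> C q"
  using pseudoinverse[OF \<alpha>, of q] by (simp add: q_def)

text \<open>The measure is the left limit of \<open>C\<close> at \<open>q\<close>, and no point
  below \<open>q\<close> satisfies \<open>\<alpha> \<le> C x\<close>. Together with
  \<open>cdf_quantile_ge\<close> this brackets \<open>\<alpha>\<close> between the masses of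
  \<open>{..<q}\<close> and \<open>{..q}\<close>.\<close>

lemma measure_lessThan_quantile_le: "measure M {..<q} \<le> \<alpha>"
proof (rule tendsto_upperbound[OF cdf_at_left])
  show "\<forall>\<^sub>F x in at_left q. C x \<le> \<alpha>"
    unfolding eventually_at_filter
  proof (intro always_eventually allI impI)
    fix x assume "x \<in> {..<q}"
    then show "C x \<le> \<alpha>"
      using pseudoinverse[OF \<alpha>, of x] q_def by auto
  qed
qed simp

text \<open>Neither score need be integrable, but the terms \<open>\<alpha> * g z\<close> cancel and
  \<open>g z\<close> survives only for \<open>z\<close> between \<open>x\<close> and
  \<open>q\<close>. Hence the difference is bounded.\<close>

lemma integrable_S_quantile_diff:
  assumes g: "mono g"
  shows "integrable M (\<lambda>z. S_quantile \<alpha> g x z - S_quantile \<alpha> g q z)"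
proof (rule integrable_const_bound[where B = "2 * \<bar>g x - g q\<bar>"])
  have "\<bar>S_quantile \<alpha> g x z - S_quantile \<alpha> g q z\<bar> \<le> 2 * \<bar>g x - g q\<bar>" for z
  proof -
    have "\<bar>\<alpha> * (g x - g q)\<bar> \<le> \<bar>g x - g q\<bar>"
      using \<alpha> by (simp add: abs_mult mult_left_le_one_le)
    moreover have "S_quantile \<alpha> g x z - S_quantile \<alpha> g q z
        = (of_bool (z \<le> x) * (g x - g z) - of_bool (z \<le> q) * (g q - g z)) - \<alpha> * (g x - g q)"
      by (simp add: S_quantile_def algebra_simps)
    moreover have "\<bar>of_bool (z \<le> x) * (g x - g z) - of_bool (z \<le> q) * (g q - g z)\<bar> \<le> \<bar>g x - g q\<bar>"
      using monoD[OF g, of x z] monoD[OF g, of z x] monoD[OF g, of q z] monoD[OF g, of z q]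
      by (auto split: split_of_bool)
    ultimately show ?thesis
      using abs_triangle_ineq4[of "of_bool (z \<le> x) * (g x - g z) - of_bool (z \<le> q) * (g q - g z)"
          "\<alpha> * (g x - g q)"] by simp
  qed
  then show "AE z in M. norm (S_quantile \<alpha> g x z - S_quantile \<alpha> g q z) \<le> 2 * \<bar>g x - g q\<bar>"
    by simp
qed (use g in measurable)

text \<open>For \<open>q \<le> x\<close> the difference is
  \<open>(g x - g q) * (indicator {..q} z - \<alpha>)\<close>, plus \<open>g x - g z\<close> on
  \<open>{q<..x}\<close>. The first term has non-negative mean because
  \<open>\<alpha> \<le> C q\<close>; the minorant \<open>?l\<close> keeps the second only on
  \<open>{q<..m}\<close>, where it is at least \<open>g x - g m\<close>.\<close>

lemma integral_S_quantile_diff_right: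
  assumes g: "mono g" and m: "q \<le> m" "m \<le> x"
  shows "(g x - g m) * (C m - C q) \<le> (\<integral>z. S_quantile \<alpha> g x z - S_quantile \<alpha> g q z \<partial>M)"
proof -
  let ?l = "\<lambda>z. (g x - g q) * (indicator {..q} z - \<alpha>) + (g x - g m) * indicator {q<..m} z"
  have "(g x - g m) * (C m - C q) \<le> (g x - g q) * (C q - \<alpha>) + (g x - g m) * (C m - C q)"
    using cdf_quantile_ge monoD[OF g, of q x] m by simp
  also have "\<dots> = (\<integral>z. ?l z \<partial>M)"
    using m by (simp add: cdf_def2 measure_greaterThanAtMost prob_space[simplified] algebra_simps less_top[symmetric])
  also have "\<dots> \<le> (\<integral>z. S_quantile \<alpha> g x z - S_quantile \<alpha> g q z \<partial>M)"
  proof (rule integral_mono)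
    show "integrable M ?l"
      by (simp add: less_top[symmetric])
    fix z show "?l z \<le> S_quantile \<alpha> g x z - S_quantile \<alpha> g q z"
      using m monoD[OF g, of z m] monoD[OF g, of z x]
      by (auto simp: S_quantile_def indicator_def algebra_simps split: split_of_bool)
  qed (rule integrable_S_quantile_diff[OF g])
  finally show ?thesis .
qed

text \<open>The mirror image, based on the mass of the open half-line \<open>{..<q}\<close>. A
  possible atom at \<open>q\<close> must not be counted, so the extra term is kept on an interval
  \<open>{m<..m'}\<close> that ends strictly below \<open>q\<close>.\<close>

lemma integral_S_quantile_diff_left:
  assumes g: "mono g" and m: "x \<le> m" "m \<le> m'" "m' < q"
  shows "(g m - g x) * (C m' - C m) \<le> (\<integral>z. S_quantile \<alpha> g x z - S_quantile \<alpha> g q z \<partial>M)"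
proof -
  let ?l = "\<lambda>z. (g q - g x) * (\<alpha> - indicator {..<q} z) + (g m - g x) * indicator {m<..m'} z"
  have "(g m - g x) * (C m' - C m)
      \<le> (g q - g x) * (\<alpha> - measure M {..<q}) + (g m - g x) * (C m' - C m)"
    using measure_lessThan_quantile_le monoD[OF g, of x q] m by simp
  also have "\<dots> = (\<integral>z. ?l z \<partial>M)"
    using m by (simp add: cdf_def2 measure_greaterThanAtMost prob_space[simplified] algebra_simps less_top[symmetric])
  also have "\<dots> \<le> (\<integral>z. S_quantile \<alpha> g x z - S_quantile \<alpha> g q z \<partial>M)"
  proof (rule integral_mono)
    show "integrable M ?l"
      by (simp add: less_top[symmetric])
    fix z show "?l z \<le> S_quantile \<alpha> g x z - S_quantile \<alpha> g q z"
      using m monoD[OF g, of m z] monoD[OF g, of x z]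
      by (cases z q rule: linorder_cases)
        (auto simp: S_quantile_def indicator_def algebra_simps split: split_of_bool)
  qed (rule integrable_S_quantile_diff[OF g])
  finally show ?thesis .
qed

lemma integral_S_quantile_diff_nonneg:
  assumes g: "mono g"
  shows "0 \<le> (\<integral>z. S_quantile \<alpha> g x z - S_quantile \<alpha> g q z \<partial>M)"
  \<comment> \<open>Degenerate intermediate points, \<open>m = q\<close> on the right and
    \<open>m = m' = x\<close> on the left, make the lower bounds zero.\<close>
  using integral_S_quantile_diff_right[OF g, of q x] integral_S_quantile_diff_left[OF g, of x x x]
  by (cases "q \<le> x") auto

text \<open>With intermediate points strictly inside the gap between \<open>x\<close> and
  \<open>q\<close>, strict monotonicity of \<open>C\<close> gives the interval positive mass and
  that of \<open>g\<close> gives it positive weight.\<close>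

lemma integral_S_quantile_diff_pos:
  assumes g: "strict_mono g" and C: "strict_mono C" and x: "x \<noteq> q"
  shows "0 < (\<integral>z. S_quantile \<alpha> g x z - S_quantile \<alpha> g q z \<partial>M)"
proof (cases "q < x")
  case True
  then obtain m where m: "q < m" "m < x" using dense by blast
  have "0 < (g x - g m) * (C m - C q)"
    using m g C by (intro mult_pos_pos) (auto simp: strict_mono_less)
  with integral_S_quantile_diff_right[OF strict_mono_mono[OF g], of m x] m show ?thesis by simp
next
  case False
  then obtain m where m: "x < m" "m < q" using x dense[of x q] by auto
  then obtain m' where m': "m < m'" "m' < q" using dense by blast
  have "0 < (g m - g x) * (C m' - C m)"
    using m m' g C by (intro mult_pos_pos) (auto simp: strict_mono_less)
  with integral_S_quantile_diff_left[OF strict_mono_mono[OF g], of x m m'] m m'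
  show ?thesis by simp
qed

lemma nn_integral_S_quantile_le:
  assumes g: "mono g"
  shows "(\<integral>\<^sup>+z. ennreal (S_quantile \<alpha> g q z) \<partial>M) \<le> (\<integral>\<^sup>+z. ennreal (S_quantile \<alpha> g x z) \<partial>M)"
  using g \<alpha> by (intro nn_integral_le_of_integral_diff_nonneg integrable_S_quantile_diff
      integral_S_quantile_diff_nonneg S_quantile_nonneg) (auto simp: measurable_finite_borel)

lemma nn_integral_S_quantile_less:
  assumes g: "strict_mono g" and C: "strict_mono C" and x: "x \<noteq> q"
    and fin: "(\<integral>\<^sup>+z. ennreal (S_quantile \<alpha> g q z) \<partial>M) < \<infinity>"
  shows "(\<integral>\<^sup>+z. ennreal (S_quantile \<alpha> g q z) \<partial>M) < (\<integral>\<^sup>+z. ennreal (S_quantile \<alpha> g x z) \<partial>M)"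
  using strict_mono_mono[OF g] \<alpha> fin integral_S_quantile_diff_pos[OF g C x]
  by (intro nn_integral_less_of_integral_diff_pos integrable_S_quantile_diff S_quantile_nonneg)
    (auto simp: measurable_finite_borel)

text \<open>The quantile function pushes the uniform distribution on \<open>(0, 1)\<close> forward to \<open>M\<close>, and
  \<open>max 0 (q - I u)\<close> vanishes for \<open>u \<ge> \<alpha>\<close>.\<close>

lemma es_gain_quantile:
  assumes ES: "ES_real \<alpha> C"
  shows "integrable M (es_gain \<alpha> q)" and "(\<integral>z. es_gain \<alpha> q z \<partial>M) = - ES \<alpha> C"
proof -
  let ?U = "restrict_space lborel {0<..<1::real}"
  let ?f = "\<lambda>z. max 0 (q - z)"
  have [measurable]: "I \<in> borel_measurable ?U"
    using measurable_CI by (simp cong: measurable_cong_sets add: sets_restrict_space)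
  have VaR: "VaR u C = - I u" for u by (simp add: VaR_def)
  have int: "set_integrable lborel {0<..<\<alpha>} I"
    using ES by (simp add: ES_real_def VaR set_integrable_def)
  have f_I: "indicator {0<..<1} u * ?f (I u) = indicator {0<..<\<alpha>} u * (q - I u)" for u
  proof (cases "0 < u \<and> u < 1")
    case True
    have "I u \<le> q" if "u \<le> \<alpha>"
      using that mono_I True \<alpha> by (auto simp: mono_on_def q_def)
    moreover have "q \<le> I u" if "\<alpha> \<le> u"
      using that mono_I True \<alpha> by (auto simp: mono_on_def q_def)
    ultimately show ?thesis
      using True by (auto simp: indicator_def)
  qed (use \<alpha> in auto)
  have const: "set_integrable lborel {0<..<\<alpha>} (\<lambda>u. q)"
    using \<alpha> by (simp add: set_integrable_def less_top[symmetric])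
  have "integrable M ?f \<longleftrightarrow> integrable ?U (\<lambda>u. ?f (I u))"
    by (subst distr_I_eq_M[symmetric]) (rule integrable_distr_eq; measurable)
  also have "\<dots> \<longleftrightarrow> set_integrable lborel {0<..<\<alpha>} (\<lambda>u. q - I u)"
    by (subst integrable_restrict_space) (simp_all add: f_I set_integrable_def)
  finally have f: "integrable M ?f"
    using set_integral_diff(1)[OF const int] by simp
  have "(\<integral>z. ?f z \<partial>M) = (\<integral>u. ?f (I u) \<partial>?U)"
    by (subst distr_I_eq_M[symmetric]) (rule integral_distr; measurable)
  also have "\<dots> = (LINT u:{0<..<\<alpha>}|lborel. q - I u)"
    by (subst integral_restrict_space) (simp_all add: f_I set_lebesgue_integral_def)
  also have "\<dots> = (LINT u:{0<..<\<alpha>}|lborel. q) - (LINT u:{0<..<\<alpha>}|lborel. I u)"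
    by (rule set_integral_diff(2)[OF const int])
  also have "(LINT u:{0<..<\<alpha>}|lborel. I u) = - (\<alpha> * ES \<alpha> C)"
    using \<alpha> by (simp add: ES_def VaR set_lebesgue_integral_def)
  also have "(LINT u:{0<..<\<alpha>}|lborel. q) = q * \<alpha>"
    using \<alpha> by (simp add: set_lebesgue_integral_def)
  finally have f_eq: "(\<integral>z. ?f z \<partial>M) = q * \<alpha> + \<alpha> * ES \<alpha> C" by simp
  show "integrable M (es_gain \<alpha> q)"
    unfolding es_gain_def using f by simp
  show "(\<integral>z. es_gain \<alpha> q z \<partial>M) = - ES \<alpha> C"
    unfolding es_gain_def using f f_eq \<alpha> by (simp add: field_simps prob_space[simplified])
qed

text \<open>The gain at \<open>x\<close> is the gain at \<open>q\<close> minus a multiple of a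
  quantile score difference, which is integrable with non-negative mean.\<close>

lemma es_gain_le_quantile:
  assumes ES: "ES_real \<alpha> C"
  shows "integrable M (es_gain \<alpha> x)" and "(\<integral>z. es_gain \<alpha> x z \<partial>M) \<le> - ES \<alpha> C"
proof -
  let ?d = "\<lambda>z. S_quantile \<alpha> id x z - S_quantile \<alpha> id q z"
  have d: "integrable M ?d" "0 \<le> (\<integral>z. ?d z \<partial>M)"
    by (auto intro!: integrable_S_quantile_diff integral_S_quantile_diff_nonneg simp: mono_def)
  have eq: "es_gain \<alpha> x = (\<lambda>z. es_gain \<alpha> q z - ?d z / \<alpha>)"
    using \<alpha> by (subst S_quantile_id_diff) (auto simp: field_simps)
  show "integrable M (es_gain \<alpha> x)"
    unfolding eq using d es_gain_quantile(1)[OF ES] by simp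
  show "(\<integral>z. es_gain \<alpha> x z \<partial>M) \<le> - ES \<alpha> C"
    unfolding eq using d es_gain_quantile[OF ES] \<alpha> by simp
qed

text \<open>The mean difference is \<open>max 0 (- ES)\<close> minus, if \<open>a\<close> holds, a
  mean gain of at most \<open>- ES\<close>. A wrong \<open>a\<close> costs at least
  \<open>\<bar>ES\<bar>\<close>; at \<open>ES = 0\<close> this gives no penalty, hence the extra
  premise for strictness.\<close>

lemma es_score_diff:
  assumes ES: "ES_real \<alpha> C"
  shows "integrable M (\<lambda>z. es_score \<alpha> a x z - es_score \<alpha> (ES \<alpha> C \<le> 0) q z)"
    and "0 \<le> (\<integral>z. es_score \<alpha> a x z - es_score \<alpha> (ES \<alpha> C \<le> 0) q z \<partial>M)"
    and "a \<noteq> (ES \<alpha> C \<le> 0) \<Longrightarrow> ES \<alpha> C \<noteq> 0 \<Longrightarrow>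
      0 < (\<integral>z. es_score \<alpha> a x z - es_score \<alpha> (ES \<alpha> C \<le> 0) q z \<partial>M)"
proof -
  have eq: "es_score \<alpha> a x z - es_score \<alpha> (ES \<alpha> C \<le> 0) q z
      = of_bool (ES \<alpha> C \<le> 0) * es_gain \<alpha> q z - of_bool a * es_gain \<alpha> x z" for z
    by (simp add: es_score_def)
  note gain = es_gain_le_quantile[OF ES, of x] es_gain_quantile[OF ES]
  show "integrable M (\<lambda>z. es_score \<alpha> a x z - es_score \<alpha> (ES \<alpha> C \<le> 0) q z)"
    unfolding eq using gain by simp
  have int: "(\<integral>z. es_score \<alpha> a x z - es_score \<alpha> (ES \<alpha> C \<le> 0) q z \<partial>M)
      = - of_bool (ES \<alpha> C \<le> 0) * ES \<alpha> C - of_bool a * (\<integral>z. es_gain \<alpha> x z \<partial>M)"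
    unfolding eq using gain by simp
  show "0 \<le> (\<integral>z. es_score \<alpha> a x z - es_score \<alpha> (ES \<alpha> C \<le> 0) q z \<partial>M)"
    unfolding int using gain by auto
  show "0 < (\<integral>z. es_score \<alpha> a x z - es_score \<alpha> (ES \<alpha> C \<le> 0) q z \<partial>M)"
    if "a \<noteq> (ES \<alpha> C \<le> 0)" "ES \<alpha> C \<noteq> 0"
    unfolding int using gain that by auto
qed

lemma nn_integral_es_score_le:
  assumes ES: "ES_real \<alpha> C"
  shows "(\<integral>\<^sup>+z. ennreal (es_score \<alpha> (ES \<alpha> C \<le> 0) q z) \<partial>M)
    \<le> (\<integral>\<^sup>+z. ennreal (es_score \<alpha> a x z) \<partial>M)"
  using es_score_diff[OF ES] es_score_nonneg[OF \<alpha>]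
  by (intro nn_integral_le_of_integral_diff_nonneg) (auto simp: measurable_finite_borel)

lemma nn_integral_es_score_less:
  assumes ES: "ES_real \<alpha> C" and a: "a \<noteq> (ES \<alpha> C \<le> 0)" "ES \<alpha> C \<noteq> 0"
    and fin: "(\<integral>\<^sup>+z. ennreal (es_score \<alpha> (ES \<alpha> C \<le> 0) q z) \<partial>M) < \<infinity>"
  shows "(\<integral>\<^sup>+z. ennreal (es_score \<alpha> (ES \<alpha> C \<le> 0) q z) \<partial>M)
    < (\<integral>\<^sup>+z. ennreal (es_score \<alpha> a x z) \<partial>M)"
  using es_score_diff[OF ES] es_score_nonneg[OF \<alpha>] a fin
  by (intro nn_integral_less_of_integral_diff_pos) (auto simp: measurable_finite_borel)

end

end

text \<open>This splits equality of two total scores into equality of their quantile and expected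
  shortfall parts; finiteness permits cancellation.\<close>

lemma ennreal_add_eq_imp_eq:
  fixes a b c d :: ennreal
  assumes "a \<le> c" "b \<le> d" "a + b = c + d" "a < \<infinity>" "b < \<infinity>"
  shows "a = c" "b = d"
proof -
  have "b + c \<le> b + a" "a + d \<le> a + b"
    using assms add_left_mono[of b d c] add_right_mono[of a c d] by (simp_all add: add.commute)
  then have "c \<le> a" "d \<le> b"
    using assms by (auto simp: ennreal_add_left_cancel_le)
  with assms show "a = c" "b = d" by auto
qed

section \<open>Scores of the law of a random vector\<close>

lemma ereal_integral_nonneg:
  assumes "\<And>x. 0 \<le> f x"
  shows "ereal_integral M f = enn2ereal (\<integral>\<^sup>+x. e2ennreal (f x) \<partial>M)"
  using assms by (simp add: ereal_integral_def e2ennreal_neg zero_ennreal.rep_eq)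

lemma S_elem_eq_es_score:
  fixes \<Lambda> :: "real^'d \<Rightarrow> real"
  assumes "\<Lambda> \<in> borel_measurable borel" "0 < \<alpha>" "\<alpha> < 1"
  shows "S_elem \<alpha> \<Lambda> k v A y = es_score \<alpha> (k \<in> A) (- v k) (\<Lambda> (y + k))"
proof -
  have "U2 \<alpha> \<Lambda> v k y = es_gain \<alpha> (- v k) (\<Lambda> (y + k))"
    using assms by (auto simp: U2_def es_gain_def field_simps split: split_of_bool)
  then show ?thesis
    using assms by (auto simp: S_elem_def es_score_def R_ES_return indicator_def)
qed

text \<open>Only the law of the random vector is kept, not the sample space. The sublocale
  \<open>agg\<close> below supplies the one-dimensional results at every shift
  \<open>k\<close>.\<close>

locale aggregated_law = prob_space F
  for F :: "(real^'d) measure" and \<Lambda> :: "real^'d \<Rightarrow> real" and \<alpha> :: real +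
  assumes sets_F [measurable_cong]: "sets F = sets borel"
    and \<Lambda> [measurable]: "\<Lambda> \<in> borel_measurable borel"
    and \<alpha>: "0 < \<alpha>" "\<alpha> < 1"
    and ES_real: "\<And>k. ES_real \<alpha> (agg_df \<Lambda> F k)"
begin

abbreviation agg :: "real^'d \<Rightarrow> real measure" where
  "agg k \<equiv> distr F borel (\<lambda>y. \<Lambda> (y + k))"

sublocale agg: cdf_distribution "agg k" for k
  by (simp add: cdf_distribution_def)

lemma minus_T_VaR: "- T_VaR \<alpha> \<Lambda> F k = agg.I k \<alpha>"
  by (simp add: T_VaR_def VaR_def agg_df_def)

lemma mem_R_ES: "k \<in> R_ES \<alpha> \<Lambda> F \<longleftrightarrow> ES \<alpha> (cdf (agg k)) \<le> 0"
  by (simp add: R_ES_def agg_df_def)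

lemma ES_real_agg: "ES_real \<alpha> (cdf (agg k))"
  using ES_real by (simp add: agg_df_def)

text \<open>By the Galois property of the quantile,
  \<open>- T_VaR \<alpha> \<Lambda> F k \<le> x\<close> means
  \<open>\<alpha> \<le> cdf (agg k) x\<close>, and this distribution function is measurable in
  \<open>k\<close> as a parameter integral.\<close>

lemma T_VaR_measurable: "T_VaR \<alpha> \<Lambda> F \<in> borel_measurable borel"
proof -
  have [measurable]: "(\<lambda>k. cdf (agg k) x) \<in> borel_measurable borel" for x
  proof -
    have "cdf (agg k) x = enn2real (\<integral>\<^sup>+y. indicator {..x} (\<Lambda> (y + k)) \<partial>F)" for k
    proof -
      have "emeasure (agg k) {..x} = (\<integral>\<^sup>+z. indicator {..x} z \<partial>agg k)"
        by simp
      also have "\<dots> = (\<integral>\<^sup>+y. indicator {..x} (\<Lambda> (y + k)) \<partial>F)"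
        by (rule nn_integral_distr) auto
      finally show ?thesis by (simp add: cdf_def measure_def)
    qed
    then show ?thesis by simp
  qed
  have "(\<lambda>k. - T_VaR \<alpha> \<Lambda> F k) \<in> borel_measurable borel"
  proof (rule borel_measurableI_le)
    fix x
    have "{k \<in> space borel. - T_VaR \<alpha> \<Lambda> F k \<le> x} = {k \<in> space borel. \<alpha> \<le> cdf (agg k) x}"
      by (simp only: minus_T_VaR agg.pseudoinverse[OF \<alpha>, symmetric])
    also have "\<dots> \<in> sets borel" by measurable
    finally show "{k \<in> space borel. - T_VaR \<alpha> \<Lambda> F k \<le> x} \<in> sets borel" .
  qed
  then show ?thesis
    using borel_measurable_uminus[of "\<lambda>k. - T_VaR \<alpha> \<Lambda> F k" borel] by simp
qed

definition mean_quantile_score :: "(real \<Rightarrow> real) \<Rightarrow> (real^'d \<Rightarrow> real) \<Rightarrow> real^'d \<Rightarrow> ennreal" where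
  "mean_quantile_score g v k = (\<integral>\<^sup>+y. ennreal (S_quantile \<alpha> g (- v k) (\<Lambda> (y + k))) \<partial>F)"

definition mean_elem_score ::
    "(real^'d \<Rightarrow> real) \<Rightarrow> (real^'d) set \<Rightarrow> real^'d \<Rightarrow> ennreal" where
  "mean_elem_score v A k = (\<integral>\<^sup>+y. ennreal (S_elem \<alpha> \<Lambda> k v A y) \<partial>F)"

lemma mean_quantile_score_agg:
  assumes [measurable]: "mono g"
  shows "mean_quantile_score g v k = (\<integral>\<^sup>+z. ennreal (S_quantile \<alpha> g (- v k) z) \<partial>agg k)"
proof -
  have [measurable]: "S_quantile \<alpha> g (- v k) \<in> borel_measurable borel"
    by (rule S_quantile_measurable) fact
  show ?thesis
    unfolding mean_quantile_score_def by (subst nn_integral_distr) auto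
qed

lemma mean_elem_score_agg:
  "mean_elem_score v A k = (\<integral>\<^sup>+z. ennreal (es_score \<alpha> (k \<in> A) (- v k) z) \<partial>agg k)"
  unfolding mean_elem_score_def S_elem_eq_es_score[OF \<Lambda> \<alpha>] by (subst nn_integral_distr) auto

lemma mean_quantile_score_le:
  "mono g \<Longrightarrow> mean_quantile_score g (T_VaR \<alpha> \<Lambda> F) k \<le> mean_quantile_score g v k"
  unfolding mean_quantile_score_agg minus_T_VaR by (rule agg.nn_integral_S_quantile_le[OF \<alpha> refl])

lemma mean_quantile_score_less:
  assumes "strict_mono g" "strict_mono (cdf (agg k))" "v k \<noteq> T_VaR \<alpha> \<Lambda> F k"
    and "mean_quantile_score g (T_VaR \<alpha> \<Lambda> F) k < \<infinity>"
  shows "mean_quantile_score g (T_VaR \<alpha> \<Lambda> F) k < mean_quantile_score g v k"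
proof -
  have "- v k \<noteq> agg.I k \<alpha>"
    using assms(3) minus_T_VaR[of k] by linarith
  with assms show ?thesis
    unfolding mean_quantile_score_agg[OF strict_mono_mono[OF assms(1)]] minus_T_VaR
    by (intro agg.nn_integral_S_quantile_less[OF \<alpha> refl])
qed

lemma mean_elem_score_le:
  "mean_elem_score (T_VaR \<alpha> \<Lambda> F) (R_ES \<alpha> \<Lambda> F) k \<le> mean_elem_score v A k"
  unfolding mean_elem_score_agg minus_T_VaR mem_R_ES
  by (rule agg.nn_integral_es_score_le[OF \<alpha> refl ES_real_agg])

lemma mean_elem_score_less:
  assumes "k \<in> A \<longleftrightarrow> k \<notin> R_ES \<alpha> \<Lambda> F" "ES \<alpha> (agg_df \<Lambda> F k) \<noteq> 0"
    and "mean_elem_score (T_VaR \<alpha> \<Lambda> F) (R_ES \<alpha> \<Lambda> F) k < \<infinity>"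
  shows "mean_elem_score (T_VaR \<alpha> \<Lambda> F) (R_ES \<alpha> \<Lambda> F) k < mean_elem_score v A k"
  using assms unfolding mean_elem_score_agg minus_T_VaR mem_R_ES
  by (intro agg.nn_integral_es_score_less[OF \<alpha> refl ES_real_agg]) (auto simp: agg_df_def)

lemma mean_score_S_elem:
  "mean_score (\<lambda>v A y. ereal (S_elem \<alpha> \<Lambda> k v A y)) v A F = enn2ereal (mean_elem_score v A k)"
  unfolding mean_score_def mean_elem_score_def
  by (subst ereal_integral_nonneg)
    (simp_all add: S_elem_eq_es_score[OF \<Lambda> \<alpha>] es_score_nonneg[OF \<alpha>])

lemma measurable_scores:
  assumes g: "(\<lambda>(k, x). g k x) \<in> borel_measurable (borel \<Otimes>\<^sub>M borel)"
    and [measurable]: "v \<in> borel_measurable borel" "A \<in> sets borel"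
  shows "(\<lambda>(k, y). S_quantile \<alpha> (g k) (- v k) (\<Lambda> (y + k))) \<in> borel_measurable (borel \<Otimes>\<^sub>M borel)"
    and "(\<lambda>(k, y). S_elem \<alpha> \<Lambda> k v A y) \<in> borel_measurable (borel \<Otimes>\<^sub>M borel)"
proof -
  \<comment> \<open>Joint measurability of \<open>g\<close>, restated as a composition rule because
    both arguments of \<open>g\<close> vary with the pair \<open>(k, y)\<close>.\<close>
  have [measurable (raw)]: "(\<lambda>p. g (a p) (b p)) \<in> borel_measurable N"
    if "a \<in> borel_measurable N" "b \<in> borel_measurable N" for a b and N :: "'z measure"
    using measurable_compose[OF measurable_Pair[OF that] g] by simp
  show "(\<lambda>(k, y). S_quantile \<alpha> (g k) (- v k) (\<Lambda> (y + k))) \<in> borel_measurable (borel \<Otimes>\<^sub>M borel)"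
    unfolding S_quantile_def by measurable
  show "(\<lambda>(k, y). S_elem \<alpha> \<Lambda> k v A y) \<in> borel_measurable (borel \<Otimes>\<^sub>M borel)"
    unfolding S_elem_eq_es_score[OF \<Lambda> \<alpha>] es_score_def es_gain_def by measurable
qed

end

section \<open>Mixtures of the elementary scores over \<open>k\<close>\<close>

locale score_mixture = aggregated_law F \<Lambda> \<alpha>
  for F :: "(real^'d) measure" and \<Lambda> :: "real^'d \<Rightarrow> real" and \<alpha> :: real +
  fixes \<pi>1 \<pi>2 :: "(real^'d) measure" and g :: "real^'d \<Rightarrow> real \<Rightarrow> real"
  assumes sets_\<pi> [measurable_cong]: "sets \<pi>1 = sets borel" "sets \<pi>2 = sets borel"
    and sigma_finite: "sigma_finite_measure \<pi>1" "sigma_finite_measure \<pi>2"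
    and mono_g: "\<And>k. mono (g k)"
    and g: "(\<lambda>(k, x). g k x) \<in> borel_measurable (borel \<Otimes>\<^sub>M borel)"
begin

lemma measurable_mean_scores:
  assumes "v \<in> borel_measurable borel" "A \<in> sets borel"
  shows "(\<lambda>k. mean_quantile_score (g k) v k) \<in> borel_measurable \<pi>1"
    and "mean_elem_score v A \<in> borel_measurable \<pi>2"
proof -
  note [measurable] = measurable_scores[OF g assms]
  show "(\<lambda>k. mean_quantile_score (g k) v k) \<in> borel_measurable \<pi>1"
    unfolding mean_quantile_score_def by measurable
  show "mean_elem_score v A \<in> borel_measurable \<pi>2"
    unfolding mean_elem_score_def by measurable
qed

text \<open>All scores are non-negative, so the extended integrals are non-negative integrals and
  Tonelli's theorem for \<open>\<pi>1\<close> or \<open>\<pi>2\<close> with \<open>F\<close>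
  exchanges their order.\<close>

lemma mean_score_S_mix:
  assumes "v \<in> borel_measurable borel" "A \<in> sets borel"
  shows "mean_score (S_mix \<alpha> \<Lambda> g \<pi>1 \<pi>2) v A F = enn2ereal
    ((\<integral>\<^sup>+k. mean_quantile_score (g k) v k \<partial>\<pi>1) + (\<integral>\<^sup>+k. mean_elem_score v A k \<partial>\<pi>2))"
proof -
  note [measurable] = measurable_scores[OF g assms]
  interpret \<pi>1: sigma_finite_measure \<pi>1 by (rule sigma_finite)
  interpret \<pi>2: sigma_finite_measure \<pi>2 by (rule sigma_finite)
  interpret p1: pair_sigma_finite \<pi>1 F ..
  interpret p2: pair_sigma_finite \<pi>2 F ..
  let ?a = "\<lambda>k y. ennreal (S_quantile \<alpha> (g k) (- v k) (\<Lambda> (y + k)))"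
  let ?b = "\<lambda>k y. ennreal (S_elem \<alpha> \<Lambda> k v A y)"
  have mix: "S_mix \<alpha> \<Lambda> g \<pi>1 \<pi>2 v A y = enn2ereal ((\<integral>\<^sup>+k. ?a k y \<partial>\<pi>1) + (\<integral>\<^sup>+k. ?b k y \<partial>\<pi>2))" for y
    unfolding S_mix_def using mono_g
    by (simp add: ereal_integral_nonneg S_quantile_nonneg[OF _ \<alpha>] plus_ennreal.rep_eq
        S_elem_eq_es_score[OF \<Lambda> \<alpha>] es_score_nonneg[OF \<alpha>])
  have "mean_score (S_mix \<alpha> \<Lambda> g \<pi>1 \<pi>2) v A F
      = enn2ereal (\<integral>\<^sup>+y. (\<integral>\<^sup>+k. ?a k y \<partial>\<pi>1) + (\<integral>\<^sup>+k. ?b k y \<partial>\<pi>2) \<partial>F)"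
    by (simp add: mean_score_def ereal_integral_nonneg mix)
  also have "(\<integral>\<^sup>+y. (\<integral>\<^sup>+k. ?a k y \<partial>\<pi>1) + (\<integral>\<^sup>+k. ?b k y \<partial>\<pi>2) \<partial>F)
      = (\<integral>\<^sup>+y. (\<integral>\<^sup>+k. ?a k y \<partial>\<pi>1) \<partial>F) + (\<integral>\<^sup>+y. (\<integral>\<^sup>+k. ?b k y \<partial>\<pi>2) \<partial>F)"
    by (rule nn_integral_add; measurable)
  also have "(\<integral>\<^sup>+y. (\<integral>\<^sup>+k. ?a k y \<partial>\<pi>1) \<partial>F) = (\<integral>\<^sup>+k. mean_quantile_score (g k) v k \<partial>\<pi>1)"
    unfolding mean_quantile_score_def by (rule p1.Fubini') measurable
  also have "(\<integral>\<^sup>+y. (\<integral>\<^sup>+k. ?b k y \<partial>\<pi>2) \<partial>F) = (\<integral>\<^sup>+k. mean_elem_score v A k \<partial>\<pi>2)"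
    unfolding mean_elem_score_def by (rule p2.Fubini') measurable
  finally show ?thesis .
qed

text \<open>One pair minimises the mean score at every \<open>k\<close> at once, so integrating over
  \<open>k\<close> preserves the inequality.\<close>

lemma mean_score_S_mix_le:
  assumes "v \<in> borel_measurable borel" "A \<in> sets borel" "R_ES \<alpha> \<Lambda> F \<in> sets borel"
  shows "mean_score (S_mix \<alpha> \<Lambda> g \<pi>1 \<pi>2) (T_VaR \<alpha> \<Lambda> F) (R_ES \<alpha> \<Lambda> F) F
    \<le> mean_score (S_mix \<alpha> \<Lambda> g \<pi>1 \<pi>2) v A F"
  unfolding mean_score_S_mix[OF assms(1,2)] mean_score_S_mix[OF T_VaR_measurable assms(3)]
    less_eq_ennreal.rep_eq[symmetric]
  by (intro add_mono nn_integral_mono mean_quantile_score_le mean_elem_score_le mono_g)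

text \<open>Equality of the finite totals forces equality of both parts, and then of the pointwise
  ordered integrands almost everywhere. Where these are finite, the strict inequalities rule out any
  deviation, except in \<open>A\<close> at points of zero expected shortfall.\<close>

lemma AE_of_mean_score_S_mix_eq:
  assumes v: "v \<in> borel_measurable borel" "A \<in> sets borel" and R: "R_ES \<alpha> \<Lambda> F \<in> sets borel"
    and strict: "\<And>k. strict_mono (g k)" "\<And>k. strict_mono (agg_df \<Lambda> F k)"
    and fin: "mean_score (S_mix \<alpha> \<Lambda> g \<pi>1 \<pi>2) (T_VaR \<alpha> \<Lambda> F) (R_ES \<alpha> \<Lambda> F) F < \<infinity>"
    and eq: "mean_score (S_mix \<alpha> \<Lambda> g \<pi>1 \<pi>2) (T_VaR \<alpha> \<Lambda> F) (R_ES \<alpha> \<Lambda> F) F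
      = mean_score (S_mix \<alpha> \<Lambda> g \<pi>1 \<pi>2) v A F"
  shows "AE k in \<pi>1. v k = T_VaR \<alpha> \<Lambda> F k"
    and "AE k in \<pi>2. (k \<in> A \<longleftrightarrow> k \<in> R_ES \<alpha> \<Lambda> F) \<or> ES \<alpha> (agg_df \<Lambda> F k) = 0"
proof -
  let ?T = "T_VaR \<alpha> \<Lambda> F" and ?R = "R_ES \<alpha> \<Lambda> F"
  let ?q = "\<lambda>v k. mean_quantile_score (g k) v k"
  have q_le: "integral\<^sup>N \<pi>1 (?q ?T) \<le> integral\<^sup>N \<pi>1 (?q v)"
    by (intro nn_integral_mono mean_quantile_score_le mono_g)
  have e_le: "integral\<^sup>N \<pi>2 (mean_elem_score ?T ?R) \<le> integral\<^sup>N \<pi>2 (mean_elem_score v A)"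
    by (intro nn_integral_mono mean_elem_score_le)
  have sum: "integral\<^sup>N \<pi>1 (?q ?T) + integral\<^sup>N \<pi>2 (mean_elem_score ?T ?R)
      = integral\<^sup>N \<pi>1 (?q v) + integral\<^sup>N \<pi>2 (mean_elem_score v A)"
    using eq unfolding mean_score_S_mix[OF v] mean_score_S_mix[OF T_VaR_measurable R]
    by (simp add: enn2ereal_inject)
  have "integral\<^sup>N \<pi>1 (?q ?T) + integral\<^sup>N \<pi>2 (mean_elem_score ?T ?R) \<noteq> top"
    using fin unfolding mean_score_S_mix[OF T_VaR_measurable R] by (auto simp: ennreal_add_eq_top)
  then have fin: "integral\<^sup>N \<pi>1 (?q ?T) < \<infinity>" "integral\<^sup>N \<pi>2 (mean_elem_score ?T ?R) < \<infinity>"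
    by (auto simp: less_top[symmetric])
  have q_eq: "integral\<^sup>N \<pi>1 (?q ?T) = integral\<^sup>N \<pi>1 (?q v)"
    and e_eq: "integral\<^sup>N \<pi>2 (mean_elem_score ?T ?R) = integral\<^sup>N \<pi>2 (mean_elem_score v A)"
    using ennreal_add_eq_imp_eq[OF q_le e_le sum] fin by auto
  have "AE k in \<pi>1. ?q ?T k \<noteq> \<infinity>"
    using fin by (intro nn_integral_PInf_AE measurable_mean_scores[OF T_VaR_measurable R]) auto
  moreover have "AE k in \<pi>1. ?q ?T k = ?q v k"
    by (rule AE_eq_of_nn_integral_eq[OF _ _ _ q_eq fin(1)])
      (auto intro: measurable_mean_scores[OF v] measurable_mean_scores[OF T_VaR_measurable R]
        mean_quantile_score_le mono_g)
  ultimately show "AE k in \<pi>1. v k = ?T k"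
  proof eventually_elim
    case (elim k)
    show ?case
      using mean_quantile_score_less[OF strict(1) strict(2)[of k, unfolded agg_df_def], of v k] elim
      by (auto simp: less_top[symmetric])
  qed
  have "AE k in \<pi>2. mean_elem_score ?T ?R k \<noteq> \<infinity>"
    using fin by (intro nn_integral_PInf_AE measurable_mean_scores[OF T_VaR_measurable R]) auto
  moreover have "AE k in \<pi>2. mean_elem_score ?T ?R k = mean_elem_score v A k"
    by (rule AE_eq_of_nn_integral_eq[OF _ _ _ e_eq fin(2)])
      (auto intro: measurable_mean_scores[OF v] measurable_mean_scores[OF T_VaR_measurable R]
        mean_elem_score_le)
  ultimately show "AE k in \<pi>2. (k \<in> A \<longleftrightarrow> k \<in> ?R) \<or> ES \<alpha> (agg_df \<Lambda> F k) = 0"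
  proof eventually_elim
    case (elim k)
    show ?case
      using mean_elem_score_less[of k A v] elim by (auto simp: less_top[symmetric])
  qed
qed

end

section \<open>Closed upper sets\<close>

lemma upper_setsD:
  assumes "A \<in> upper_sets" "a \<in> A" "a \<le> b" shows "b \<in> A"
proof -
  have "A = {a + x |a x. a \<in> A \<and> 0 \<le> x}"
    using assms by (simp add: upper_sets_def)
  moreover have "b = a + (b - a)" "0 \<le> b - a"
    using assms by (auto simp: less_eq_vec_def)
  ultimately show ?thesis using assms by blast
qed

text \<open>The open orthant strictly above a point \<open>k\<close> of \<open>A - B\<close> lies in
  \<open>A\<close>, and its points close to \<open>k\<close> avoid the closed set
  \<open>B\<close>.\<close>

lemma upper_set_minus_closed_open_subset:
  fixes A B :: "(real^'d) set"
  assumes A: "A \<in> upper_sets" and B: "closed B" and "\<not> A \<subseteq> B"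
  obtains U where "open U" "U \<noteq> {}" "U \<subseteq> A - B"
proof -
  obtain k where k: "k \<in> A" "k \<notin> B" using assms by blast
  define U where "U = (\<Inter>i. {x. k $ i < x $ i}) \<inter> - B"
  have "open {x. k $ i < x $ i}" for i
    by (rule open_halfspace_component_gt_cart)
  then have "open U"
    unfolding U_def using B by (intro open_Int open_INT) auto
  moreover have "U \<subseteq> A - B"
    using upper_setsD[OF A k(1)] by (auto simp: U_def less_eq_vec_def less_imp_le)
  moreover have "U \<noteq> {}"
  proof -
    \<comment> \<open>Non-emptiness: the diagonal ray from \<open>k\<close> lies in the orthant for
      every positive \<epsilon> and, since \<open>- B\<close> is an open neighbourhood of
      \<open>k\<close>, outside \<open>B\<close> for small \<epsilon>.\<close>
    have "((\<lambda>\<epsilon>::real. k + \<epsilon> *\<^sub>R (\<chi> i. 1)) \<longlongrightarrow> k + 0 *\<^sub>R (\<chi> i. 1)) (at_right 0)"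
      by (intro tendsto_intros)
    then have "\<forall>\<^sub>F \<epsilon> in at_right 0. k + \<epsilon> *\<^sub>R (\<chi> i. 1) \<in> - B"
      by (rule topological_tendstoD) (use B k in auto)
    moreover have "\<forall>\<^sub>F \<epsilon>::real in at_right 0. 0 < \<epsilon>"
      by (rule eventually_at_right_less)
    ultimately have "\<forall>\<^sub>F \<epsilon> in at_right 0. k + \<epsilon> *\<^sub>R (\<chi> i. 1) \<in> U"
      by eventually_elim (auto simp: U_def)
    then show ?thesis
      using eventually_happens'[OF trivial_limit_at_right_real] by auto
  qed
  ultimately show thesis using that by blast
qed

lemma strictly_positive_open_null:
  assumes pos: "strictly_positive \<pi>" and sets: "sets \<pi> = sets borel"
    and U: "open U" and AE: "AE k in \<pi>. k \<notin> U"
  shows "U = {}"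
proof -
  have "U \<in> sets \<pi>" using U sets by simp
  moreover have "{k \<in> space \<pi>. k \<in> U} = U"
    using sets_eq_imp_space_eq[OF sets] by auto
  ultimately have "emeasure \<pi> U = 0"
    using AE AE_iff_measurable[of U \<pi> "\<lambda>k. k \<notin> U"] by simp
  then show ?thesis
    using pos U by (auto simp: strictly_positive_def)
qed

text \<open>The frontier of \<open>B\<close> may carry mass, so agreement off it does not settle the
  matter by measure alone. The open set found in \<open>A - B\<close> or \<open>B - A\<close> misses
  the frontier, hence would have to be null.\<close>

lemma closed_upper_sets_eq_of_AE:
  assumes A: "A \<in> closed_upper_sets" and B: "B \<in> closed_upper_sets"
    and pos: "strictly_positive \<pi>" and sets: "sets \<pi> = sets borel"
    and AE: "AE k in \<pi>. (k \<in> A \<longleftrightarrow> k \<in> B) \<or> k \<in> frontier B"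
  shows "A = B"
proof (rule ccontr)
  have upper: "A \<in> upper_sets" "B \<in> upper_sets" and closed: "closed A" "closed B"
    using A B by (auto simp: closed_upper_sets_def)
  assume "A \<noteq> B"
  then consider "\<not> A \<subseteq> B" | "\<not> B \<subseteq> A" by blast
  then obtain U where U: "open U" "U \<noteq> {}" "U \<subseteq> A - B \<or> U \<subseteq> B - A"
  proof cases
    case 1
    then obtain U where "open U" "U \<noteq> {}" "U \<subseteq> A - B"
      by (rule upper_set_minus_closed_open_subset[OF upper(1) closed(2)])
    then show thesis using that by blast
  next
    case 2
    then obtain U where "open U" "U \<noteq> {}" "U \<subseteq> B - A"
      by (rule upper_set_minus_closed_open_subset[OF upper(2) closed(1)])
    then show thesis using that by blast
  qed
  \<comment> \<open>An open set disjoint from the closed set \<open>B\<close> misses its frontier,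
    and an open subset of \<open>B\<close> lies in its interior.\<close>
  have "k \<notin> frontier B" if "k \<in> U" for k
  proof -
    have "frontier B \<subseteq> B" using closed by (simp add: frontier_subset_closed)
    moreover have "k \<in> interior B" if "U \<subseteq> B - A"
      using that \<open>k \<in> U\<close> U(1) by (intro interiorI[of U]) auto
    ultimately show ?thesis using U(3) that by (auto simp: frontier_def)
  qed
  with AE U(3) have "AE k in \<pi>. k \<notin> U" by (auto elim!: eventually_mono)
  from strictly_positive_open_null[OF pos sets U(1) this] U(2) show False by simp
qed

section \<open>Assembly of the three claims\<close>

theorem theorem5p2:
  fixes M :: "'w measure"
    and \<Lambda> :: "real^'d \<Rightarrow> real"
    and Yd :: "('w \<Rightarrow> real^'d) set"
    and Yc :: "('w \<Rightarrow> real) set"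
    and \<alpha> :: real
  assumes "prob_space M" and "atomless M"
    and "mono \<Lambda>" and "\<Lambda> \<in> borel_measurable borel"
    and "Yd \<subseteq> borel_measurable M"
    and "\<And>Y k. Y \<in> Yd \<Longrightarrow> (\<lambda>\<omega>. Y \<omega> + k) \<in> Yd"
    and "Yc \<subseteq> borel_measurable M"
    and "\<And>Y. Y \<in> Yd \<Longrightarrow> (\<lambda>\<omega>. \<Lambda> (Y \<omega>)) \<in> Yc"
    and "0 < \<alpha>" and "\<alpha> < 1"
    and "\<And>F. F \<in> laws M Yc \<Longrightarrow> ES_real \<alpha> (cdf F)"
  shows
    "((\<forall>F\<in>laws M Yd. R_ES \<alpha> \<Lambda> F \<in> upper_sets) \<longrightarrow>
       (\<forall>k. nonneg_score (\<lambda>v A y. ereal (S_elem \<alpha> \<Lambda> k v A y)) UNIV upper_sets \<and>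
            consistent_score (\<lambda>v A y. ereal (S_elem \<alpha> \<Lambda> k v A y))
              (laws M Yd) UNIV upper_sets (T_VaR \<alpha> \<Lambda>) (R_ES \<alpha> \<Lambda>)))
    \<and>
     (\<forall>(\<pi>1 :: (real^'d) measure) (\<pi>2 :: (real^'d) measure) (g :: real^'d \<Rightarrow> real \<Rightarrow> real).
       (\<forall>F\<in>laws M Yd. R_ES \<alpha> \<Lambda> F \<in> upper_sets) \<and>
       sets \<pi>1 = sets borel \<and> sigma_finite_measure \<pi>1 \<and>
       sets \<pi>2 = sets borel \<and> sigma_finite_measure \<pi>2 \<and>
       (\<forall>k. mono (g k)) \<and>
       (\<lambda>(k, x). g k x) \<in> borel_measurable (borel \<Otimes>\<^sub>M borel)
       \<longrightarrow>
       nonneg_score (S_mix \<alpha> \<Lambda> g \<pi>1 \<pi>2) (borel_measurable borel) upper_sets \<and>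
       consistent_score (S_mix \<alpha> \<Lambda> g \<pi>1 \<pi>2)
         (laws M Yd) (borel_measurable borel) upper_sets (T_VaR \<alpha> \<Lambda>) (R_ES \<alpha> \<Lambda>))
    \<and>
     (\<forall>(\<pi>1 :: (real^'d) measure) (\<pi>2 :: (real^'d) measure) (g :: real^'d \<Rightarrow> real \<Rightarrow> real) M0.
       (\<forall>F\<in>laws M Yd. R_ES \<alpha> \<Lambda> F \<in> closed_upper_sets \<and>
          {k. ES \<alpha> (agg_df \<Lambda> F k) = 0} = frontier (R_ES \<alpha> \<Lambda> F)) \<and>
       (\<forall>F\<in>laws M Yc. continuous_on UNIV (cdf F) \<and> strict_mono (cdf F)) \<and>
       (\<forall>F\<in>laws M Yd. continuous_on UNIV (T_VaR \<alpha> \<Lambda> F)) \<and>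
       sets \<pi>1 = sets borel \<and> sigma_finite_measure \<pi>1 \<and> strictly_positive \<pi>1 \<and>
       sets \<pi>2 = sets borel \<and> sigma_finite_measure \<pi>2 \<and> strictly_positive \<pi>2 \<and>
       (\<forall>k. strict_mono (g k)) \<and>
       (\<lambda>(k, x). g k x) \<in> borel_measurable (borel \<Otimes>\<^sub>M borel) \<and>
       M0 \<subseteq> laws M Yd \<and>
       (\<forall>F\<in>M0. mean_score (S_mix \<alpha> \<Lambda> g \<pi>1 \<pi>2) (T_VaR \<alpha> \<Lambda> F) (R_ES \<alpha> \<Lambda> F) F < \<infinity>)
       \<longrightarrow>
       nonneg_score (S_mix \<alpha> \<Lambda> g \<pi>1 \<pi>2) {v. continuous_on UNIV v} closed_upper_sets \<and>
       strictly_consistent_score (S_mix \<alpha> \<Lambda> g \<pi>1 \<pi>2)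
         M0 {v. continuous_on UNIV v} closed_upper_sets (T_VaR \<alpha> \<Lambda>) (R_ES \<alpha> \<Lambda>))"
proof -
  have law: "aggregated_law F \<Lambda> \<alpha>"
    and law_Yc: "distr F borel (\<lambda>y. \<Lambda> (y + k)) \<in> laws M Yc" if F: "F \<in> laws M Yd" for F k
  proof -
    obtain Y where Y: "Y \<in> Yd" "F = distr M borel Y"
      using F by (auto simp: laws_def)
    have [measurable]: "\<Lambda> \<in> borel_measurable borel" "Y \<in> borel_measurable M"
      using assms(4,5) Y by auto
    \<comment> \<open>Translation invariance of \<open>Yd\<close> puts
      \<open>\<Lambda> (Y + k)\<close> into \<open>Yc\<close>, so the assumptions on
      \<open>laws M Yc\<close> reach every shift.\<close>
    have Yc: "distr F borel (\<lambda>y. \<Lambda> (y + k)) \<in> laws M Yc" for k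
    proof -
      have "(\<lambda>\<omega>. \<Lambda> (Y \<omega> + k)) \<in> Yc"
        using assms(6)[OF Y(1)] by (rule assms(8))
      moreover have "distr F borel (\<lambda>y. \<Lambda> (y + k)) = distr M borel (\<lambda>\<omega>. \<Lambda> (Y \<omega> + k))"
        unfolding Y(2) by (subst distr_distr) (simp_all add: comp_def)
      ultimately show ?thesis by (auto simp: laws_def)
    qed
    then show "distr F borel (\<lambda>y. \<Lambda> (y + k)) \<in> laws M Yc" .
    interpret prob_space F
      unfolding Y(2) using assms(1) by (rule prob_space.prob_space_distr) measurable
    show "aggregated_law F \<Lambda> \<alpha>"
      by standard (use Y assms(4,9,10) assms(11)[OF Yc] in \<open>auto simp: agg_df_def\<close>)
  qed
  note S_elem_nonneg = S_elem_eq_es_score[OF assms(4,9,10)] es_score_nonneg[OF assms(9,10)]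
  have nonneg_mix: "nonneg_score (S_mix \<alpha> \<Lambda> g \<pi>1 \<pi>2) C \<A>"
    if "\<And>k. mono (g k)" for g and \<pi>1 \<pi>2 :: "(real^'d) measure" and C \<A>
    unfolding nonneg_score_def S_mix_def using that
    by (simp add: ereal_integral_nonneg S_quantile_nonneg[OF _ assms(9,10)] S_elem_nonneg)
  have not_MInf: "S v A y \<noteq> - \<infinity>"
    if "nonneg_score S C \<A>" "v \<in> C" "A \<in> \<A>"
    for S :: "(real^'d \<Rightarrow> real) \<Rightarrow> (real^'d) set \<Rightarrow> real^'d \<Rightarrow> ereal" and C \<A> v A y
    using that unfolding nonneg_score_def by (metis MInfty_neq_ereal(1)
        ereal_infty_less_eq(2) zero_ereal_def)
  have elem: "nonneg_score (\<lambda>v A y. ereal (S_elem \<alpha> \<Lambda> k v A y)) UNIV upper_sets" for k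
    by (simp add: nonneg_score_def S_elem_nonneg)
  have part1: "consistent_score (\<lambda>v A y. ereal (S_elem \<alpha> \<Lambda> k v A y))
      (laws M Yd) UNIV upper_sets (T_VaR \<alpha> \<Lambda>) (R_ES \<alpha> \<Lambda>)"
    if "\<forall>F\<in>laws M Yd. R_ES \<alpha> \<Lambda> F \<in> upper_sets" for k
    unfolding consistent_score_def
  proof (intro conjI ballI allI)
    fix F v A assume "F \<in> laws M Yd"
    then interpret aggregated_law F \<Lambda> \<alpha> by (rule law)
    show "mean_score (\<lambda>v A y. ereal (S_elem \<alpha> \<Lambda> k v A y)) (T_VaR \<alpha> \<Lambda> F) (R_ES \<alpha> \<Lambda> F) F
        \<le> mean_score (\<lambda>v A y. ereal (S_elem \<alpha> \<Lambda> k v A y)) v A F"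
      unfolding mean_score_S_elem less_eq_ennreal.rep_eq[symmetric] by (rule mean_elem_score_le)
  qed (use that in auto)
  have mix: "score_mixture F \<Lambda> \<alpha> \<pi>1 \<pi>2 g"
    if "F \<in> laws M Yd" "sets \<pi>1 = sets borel" "sigma_finite_measure \<pi>1"
      "sets \<pi>2 = sets borel" "sigma_finite_measure \<pi>2" "\<And>k. mono (g k)"
      "(\<lambda>(k, x). g k x) \<in> borel_measurable (borel \<Otimes>\<^sub>M borel)" for F \<pi>1 \<pi>2 g
    using that law[OF that(1)] by (simp add: score_mixture_def score_mixture_axioms_def)
  have part2: "consistent_score (S_mix \<alpha> \<Lambda> g \<pi>1 \<pi>2)
      (laws M Yd) (borel_measurable borel) upper_sets (T_VaR \<alpha> \<Lambda>) (R_ES \<alpha> \<Lambda>)"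
    if R: "\<forall>F\<in>laws M Yd. R_ES \<alpha> \<Lambda> F \<in> upper_sets"
      and \<pi>: "sets \<pi>1 = sets borel" "sigma_finite_measure \<pi>1"
        "sets \<pi>2 = sets borel" "sigma_finite_measure \<pi>2"
      and g: "\<And>k. mono (g k)" "(\<lambda>(k, x). g k x) \<in> borel_measurable (borel \<Otimes>\<^sub>M borel)"
    for \<pi>1 \<pi>2 g
    unfolding consistent_score_def
  proof (intro conjI ballI allI)
    fix F assume F: "F \<in> laws M Yd"
    interpret score_mixture F \<Lambda> \<alpha> \<pi>1 \<pi>2 g by (rule mix[OF F \<pi> g])
    show "T_VaR \<alpha> \<Lambda> F \<in> borel_measurable borel" by (rule T_VaR_measurable)
    show "R_ES \<alpha> \<Lambda> F \<in> upper_sets" using R F by blast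
    then have "R_ES \<alpha> \<Lambda> F \<in> sets borel" by (simp add: upper_sets_def)
    then show "mean_score (S_mix \<alpha> \<Lambda> g \<pi>1 \<pi>2) (T_VaR \<alpha> \<Lambda> F) (R_ES \<alpha> \<Lambda> F) F
        \<le> mean_score (S_mix \<alpha> \<Lambda> g \<pi>1 \<pi>2) v A F"
      if "v \<in> borel_measurable borel" "A \<in> upper_sets" for v A
      using that by (intro mean_score_S_mix_le) (auto simp: upper_sets_def)
  qed (rule not_MInf[OF nonneg_mix[OF g(1)]])
  have part3: "strictly_consistent_score (S_mix \<alpha> \<Lambda> g \<pi>1 \<pi>2)
      M0 {v. continuous_on UNIV v} closed_upper_sets (T_VaR \<alpha> \<Lambda>) (R_ES \<alpha> \<Lambda>)"
    if R: "\<And>F. F \<in> laws M Yd \<Longrightarrow> R_ES \<alpha> \<Lambda> F \<in> closed_upper_sets"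
        "\<And>F. F \<in> laws M Yd \<Longrightarrow> {k. ES \<alpha> (agg_df \<Lambda> F k) = 0} = frontier (R_ES \<alpha> \<Lambda> F)"
      and C: "\<And>F. F \<in> laws M Yc \<Longrightarrow> strict_mono (cdf F)"
      and T: "\<And>F. F \<in> laws M Yd \<Longrightarrow> continuous_on UNIV (T_VaR \<alpha> \<Lambda> F)"
      and \<pi>: "sets \<pi>1 = sets borel" "sigma_finite_measure \<pi>1"
        "sets \<pi>2 = sets borel" "sigma_finite_measure \<pi>2"
      and pos: "strictly_positive \<pi>1" "strictly_positive \<pi>2"
      and strict_g: "\<And>k. strict_mono (g k)" "(\<lambda>(k, x). g k x) \<in> borel_measurable (borel \<Otimes>\<^sub>M borel)"
      and M0: "M0 \<subseteq> laws M Yd"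
        "\<And>F. F \<in> M0 \<Longrightarrow>
          mean_score (S_mix \<alpha> \<Lambda> g \<pi>1 \<pi>2) (T_VaR \<alpha> \<Lambda> F) (R_ES \<alpha> \<Lambda> F) F < \<infinity>"
    for \<pi>1 \<pi>2 g M0
  proof -
    note mono = strict_mono_mono[OF strict_g(1)]
    have R': "\<forall>F\<in>laws M Yd. R_ES \<alpha> \<Lambda> F \<in> upper_sets"
      using R(1) by (auto simp: closed_upper_sets_def)
    have sub: "{v. continuous_on UNIV v} \<subseteq> borel_measurable borel" "closed_upper_sets \<subseteq> upper_sets"
      by (auto simp: closed_upper_sets_def borel_measurable_continuous_onI)
    \<comment> \<open>Continuous functions are Borel and closed upper sets are upper sets, so the
      inequality is inherited from \<open>part2\<close>.\<close>
    have "consistent_score (S_mix \<alpha> \<Lambda> g \<pi>1 \<pi>2)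
        M0 {v. continuous_on UNIV v} closed_upper_sets (T_VaR \<alpha> \<Lambda>) (R_ES \<alpha> \<Lambda>)"
      unfolding consistent_score_def
    proof (intro conjI ballI allI)
      fix F v and A :: "(real^'d) set"
      assume F: "F \<in> M0" and "v \<in> {v :: real^'d \<Rightarrow> real. continuous_on UNIV v}" "A \<in> closed_upper_sets"
      then have "v \<in> borel_measurable borel" "A \<in> upper_sets" "F \<in> laws M Yd"
        using sub M0(1) by blast+
      then show "mean_score (S_mix \<alpha> \<Lambda> g \<pi>1 \<pi>2) (T_VaR \<alpha> \<Lambda> F) (R_ES \<alpha> \<Lambda> F) F
          \<le> mean_score (S_mix \<alpha> \<Lambda> g \<pi>1 \<pi>2) v A F"
        using part2[OF R' \<pi> mono strict_g(2)] unfolding consistent_score_def by blast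
    qed ((rule not_MInf[OF nonneg_mix[OF mono]]; assumption) | (use R(1) T M0(1) in blast))+
    moreover have "v = T_VaR \<alpha> \<Lambda> F \<and> A = R_ES \<alpha> \<Lambda> F"
      if F: "F \<in> M0" and v: "continuous_on UNIV v" and A: "A \<in> closed_upper_sets"
        and eq: "mean_score (S_mix \<alpha> \<Lambda> g \<pi>1 \<pi>2) (T_VaR \<alpha> \<Lambda> F) (R_ES \<alpha> \<Lambda> F) F
          = mean_score (S_mix \<alpha> \<Lambda> g \<pi>1 \<pi>2) v A F" for F v A
    proof -
      have F': "F \<in> laws M Yd" using F M0 by blast
      interpret score_mixture F \<Lambda> \<alpha> \<pi>1 \<pi>2 g by (rule mix[OF F' \<pi> mono strict_g(2)])
      have C': "strict_mono (agg_df \<Lambda> F k)" for k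
        using C[OF law_Yc[OF F']] by (simp add: agg_df_def)
      have meas: "v \<in> borel_measurable borel" "A \<in> sets borel" "R_ES \<alpha> \<Lambda> F \<in> sets borel"
        using v A R(1)[OF F'] sub by (auto simp: upper_sets_def closed_upper_sets_def)
      note AE = AE_of_mean_score_S_mix_eq[OF meas strict_g(1) C' M0(2)[OF F] eq]
      \<comment> \<open>The set where two continuous functions differ is open; being null for the
        strictly positive \<open>\<pi>1\<close>, it is empty.\<close>
      have "{k. v k \<noteq> T_VaR \<alpha> \<Lambda> F k} = {}"
        using AE(1) v T[OF F']
        by (intro strictly_positive_open_null[OF pos(1) \<pi>(1)] open_Collect_neq) auto
      moreover have "A = R_ES \<alpha> \<Lambda> F"
      proof (rule closed_upper_sets_eq_of_AE[OF A R(1)[OF F'] pos(2) \<pi>(3)])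
        \<comment> \<open>The boundary hypothesis identifies the exceptional points of zero expected
          shortfall with the frontier.\<close>
        show "AE k in \<pi>2. (k \<in> A \<longleftrightarrow> k \<in> R_ES \<alpha> \<Lambda> F) \<or> k \<in> frontier (R_ES \<alpha> \<Lambda> F)"
          using AE(2) unfolding R(2)[OF F', symmetric] by simp
      qed
      ultimately show ?thesis by auto
    qed
    ultimately show ?thesis
      by (auto simp: strictly_consistent_score_def)
  qed
  show ?thesis
  proof (intro conjI impI allI)
    fix k assume "\<forall>F\<in>laws M Yd. R_ES \<alpha> \<Lambda> F \<in> upper_sets"
    then show "consistent_score (\<lambda>v A y. ereal (S_elem \<alpha> \<Lambda> k v A y))
        (laws M Yd) UNIV upper_sets (T_VaR \<alpha> \<Lambda>) (R_ES \<alpha> \<Lambda>)" by (rule part1)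
  qed (rule elem | (elim conjE, rule nonneg_mix, (simp add: strict_mono_mono; fail))
    | (elim conjE, rule part2; blast) | (elim conjE, rule part3; blast))+
qed

end
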